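(* Let $n$ be a positive integer. (1) For $0<s<1$ and $x,y\in B^n(s)$, $$ j_{B^n}(x,y) \le k_{B^n}(x,y) \le (1+s)\, j_{B^n}(x,y). $$ (2) Let $G\subsetneq\mathbb{R}^n$ be a domain, let $w\in G$ and let $w_0\in \partial G\cap S^{n-1}(w,\delta_G(w))$. If $s\in(0,1)$ and $x,y\in B^n(w,s\,\delta_G(w))\cap[w,w_0]$, then $$ k_G(x,y)\le (1+s)\, j_G(x,y). $$
   Context: $B^n(w,r)$ is the open Euclidean ball in $\mathbb{R}^n$ with center $w$ and radius $r$, $S^{n-1}(w,r)$ is its boundary sphere, $B^n(r)=B^n(0,r)$ and $B^n=B^n(0,1)$. $[w,w_0]$ is the closed Euclidean segment. For a domain (open connected nonempty set) $G\subsetneq\mathbb{R}^n$, $\delta_G(x)$ is the Euclidean distance from $x\in G$ to $\partial G$. For $x,y\in G$, the distance ratio metric is $$j_G(x,y)=\log\left(1+\frac{|x-y|}{\min\{\delta_G(x),\delta_G(y)\}}\right),$$ and the quasihyperbolic metric is $$k_G(x,y)=\inf_{\gamma}\int_\gamma\frac{|dz|}{\delta_G(z)},$$ where the infimum is over all rectifiable paths $\gamma$ in $G$ joining $x$ and $y$. *)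

theory Defs
  imports "HOL-Analysis.Analysis"
begin

text \<open>
  Paths are the library's paths, parametrised by \<open>{0..1}\<close>. A path is rectifiable if its length,
  the supremum of the lengths of inscribed polygons, is finite.
\<close>

definition polygon_lengths :: "real \<Rightarrow> real \<Rightarrow> (real \<Rightarrow> 'a::metric_space) \<Rightarrow> real set" where
  "polygon_lengths a b g =
     {\<Sum>i<m. dist (g (t i)) (g (t (Suc i))) |m t.
        mono_on {..m} t \<and> t 0 = a \<and> t m = b}"

definition rectifiable_path :: "(real \<Rightarrow> 'a::metric_space) \<Rightarrow> bool" where
  "rectifiable_path g \<longleftrightarrow> path g \<and> bdd_above (polygon_lengths 0 1 g)"

definition arc_length :: "(real \<Rightarrow> 'a::metric_space) \<Rightarrow> real \<Rightarrow> real" where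
  "arc_length g t = Sup (polygon_lengths 0 t g)"

text \<open>
  For a rectifiable \<open>g\<close>, the map \<open>arc_length g\<close> is continuous and nondecreasing from \<open>{0..1}\<close> onto
  \<open>{0..arc_length g 1}\<close>, and \<open>g\<close> is constant on its level sets. Hence the value below does not
  depend on the preimage chosen by \<open>inv_into\<close>.
\<close>

definition arc_length_param :: "(real \<Rightarrow> 'a::metric_space) \<Rightarrow> real \<Rightarrow> 'a" where
  "arc_length_param g u = g (inv_into {0..1} (arc_length g) u)"

definition line_integral :: "(real \<Rightarrow> 'a::metric_space) \<Rightarrow> ('a \<Rightarrow> real) \<Rightarrow> real" where
  "line_integral g \<rho> = integral {0..arc_length g 1} (\<lambda>u. \<rho> (arc_length_param g u))"

definition bdist :: "'a::metric_space set \<Rightarrow> 'a \<Rightarrow> real" where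
  "bdist G x = infdist x (frontier G)"

definition distance_ratio_metric :: "'a::metric_space set \<Rightarrow> 'a \<Rightarrow> 'a \<Rightarrow> real" where
  "distance_ratio_metric G x y = ln (1 + dist x y / min (bdist G x) (bdist G y))"

definition quasihyperbolic_metric :: "'a::metric_space set \<Rightarrow> 'a \<Rightarrow> 'a \<Rightarrow> real" where
  "quasihyperbolic_metric G x y =
     Inf {line_integral g (\<lambda>z. 1 / bdist G z) |g.
       rectifiable_path g \<and> path_image g \<subseteq> G \<and> pathstart g = x \<and> pathfinish g = y}"

definition proper_domain :: "'a::topological_space set \<Rightarrow> bool" where
  "proper_domain G \<longleftrightarrow> open G \<and> connected G \<and> G \<noteq> {} \<and> G \<noteq> UNIV"

end

theory Submission
  imports Defs
begin

text \<open>
  Parametrise a path by arc length. Since \<open>\<delta>\<close> is 1-Lipschitz, \<open>\<delta>(\<gamma>(u)) \<le> \<delta>(x) + u\<close>, and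
  integrating \<open>1 / (\<delta>(x) + u)\<close> gives \<open>j \<le> k\<close>. On a radial segment towards a nearest boundary
  point \<open>\<delta>\<close> is affine, so there the integral of \<open>1 / \<delta>\<close> equals \<open>j\<close>, which gives the second part.

  Euclidean segments are not short enough for the upper bound in the ball. Instead integrate along
  the hyperbolic geodesic from \<open>x\<close> to \<open>y\<close>, which stays in the ball of radius
  \<open>max |x| |y| < s\<close>. The density \<open>1 / (1 - |z|)\<close> is \<open>(1 + |z|) / 2\<close> times the hyperbolic density
  \<open>2 / (1 - |z|\<^sup>2)\<close>, so \<open>k\<close> is at most \<open>(1 + s) / 2\<close> times the hyperbolic distance \<open>\<rho>\<close>, and
  \<open>\<rho> \<le> 2 j\<close> follows from \<open>sinh (\<rho> / 2) = |x - y| / sqrt ((1 - |x|\<^sup>2) (1 - |y|\<^sup>2))\<close>.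
\<close>

subsection \<open>Inscribed polygons and arc length\<close>

lemma polygon_lengths_refl: "0 \<in> polygon_lengths a a g"
  unfolding polygon_lengths_def by (auto simp: mono_on_def intro!: exI[of _ 0] exI[of _ "\<lambda>_. a"])

lemma polygon_lengths_Cons:
  assumes "a \<le> c" "p \<in> polygon_lengths c b g"
  shows "dist (g a) (g c) + p \<in> polygon_lengths a b g"
proof -
  obtain m t where t: "p = (\<Sum>i<m. dist (g (t i)) (g (t (Suc i))))" "mono_on {..m} t" "t 0 = c" "t m = b"
    using assms(2) unfolding polygon_lengths_def by blast
  have "mono_on {..Suc m} (case_nat a t)"
  proof (rule mono_onI)
    fix i j assume ij: "i \<in> {..Suc m}" "j \<in> {..Suc m}" "i \<le> j"
    have "c \<le> t k" if "k \<le> m" for k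
      using mono_onD[OF t(2), of 0 k] t(3) that by simp
    then show "case_nat a t i \<le> case_nat a t j"
      using ij assms(1) mono_onD[OF t(2), of "i - 1" "j - 1"]
      by (cases i; cases j) (auto intro: order_trans)
  qed
  moreover have "dist (g a) (g c) + p
      = (\<Sum>i<Suc m. dist (g (case_nat a t i)) (g (case_nat a t (Suc i))))"
    by (subst sum.lessThan_Suc_shift) (simp add: t)
  ultimately show ?thesis
    unfolding polygon_lengths_def using t by (auto intro!: exI[of _ "Suc m"] exI[of _ "case_nat a t"])
qed

text \<open>Polygons behave like lists: each arises from the trivial polygon at \<open>b\<close> by
  prepending edges. Induction over them, with the right endpoint fixed, spares all later arguments
  the explicit vertex sequences.\<close>

lemma polygon_lengths_induct [consumes 1, case_names refl Cons]:
  assumes "p \<in> polygon_lengths a b g"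
    and refl: "P b 0"
    and Cons: "\<And>a c p. a \<le> c \<Longrightarrow> p \<in> polygon_lengths c b g \<Longrightarrow> P c p \<Longrightarrow> P a (dist (g a) (g c) + p)"
  shows "P a p"
proof -
  have "P (t 0) (\<Sum>i<m. dist (g (t i)) (g (t (Suc i))))" if "mono_on {..m} t" "t m = b" for m t
    using that
  proof (induction m arbitrary: t)
    case 0
    then show ?case using refl by simp
  next
    case (Suc m)
    have mono: "mono_on {..m} (t \<circ> Suc)"
      using Suc.prems(1) by (auto simp: mono_on_def)
    have "t 0 \<le> t 1"
      using mono_onD[OF Suc.prems(1), of 0 1] by simp
    moreover have "P (t 1) (\<Sum>i<m. dist (g (t (Suc i))) (g (t (Suc (Suc i)))))"
      using Suc.IH[OF mono] Suc.prems(2) by simp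
    moreover have "(\<Sum>i<m. dist (g (t (Suc i))) (g (t (Suc (Suc i))))) \<in> polygon_lengths (t 1) b g"
      unfolding polygon_lengths_def using mono Suc.prems(2)
      by (auto intro!: exI[of _ m] exI[of _ "t \<circ> Suc"])
    ultimately show ?case
      using Cons[of "t 0" "t 1"] by (subst sum.lessThan_Suc_shift) simp
  qed
  then show ?thesis
    using assms(1) unfolding polygon_lengths_def by auto
qed

lemma polygon_lengths_segment: "a \<le> b \<Longrightarrow> dist (g a) (g b) \<in> polygon_lengths a b g"
  using polygon_lengths_Cons[OF _ polygon_lengths_refl] by fastforce

lemma polygon_lengths_le: "p \<in> polygon_lengths a b g \<Longrightarrow> a \<le> b"
  by (induction rule: polygon_lengths_induct) auto

lemma polygon_lengths_same_endpoints:
  assumes "p \<in> polygon_lengths b b g"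
  shows "p = 0"
proof -
  \<comment> \<open>The induction moves the left endpoint, so the equality of the endpoints has to
    be part of the claim.\<close>
  have "a = b \<longrightarrow> p = 0" if "p \<in> polygon_lengths a b g" for a
    using that by (induction rule: polygon_lengths_induct) (auto dest: polygon_lengths_le)
  then show ?thesis using assms by simp
qed

lemma polygon_lengths_append:
  assumes "p \<in> polygon_lengths a b g" "q \<in> polygon_lengths b c g"
  shows "p + q \<in> polygon_lengths a c g"
  using assms(1)
  by (induction rule: polygon_lengths_induct) (auto simp: assms(2) add.assoc intro: polygon_lengths_Cons)

text \<open>By the triangle inequality, inserting \<open>b\<close> as an extra vertex can only
  lengthen a polygon. This yields the upper half of the additivity of arc length.\<close>

lemma polygon_lengths_split:
  assumes "p \<in> polygon_lengths a c g" "a \<le> b" "b \<le> c"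
  shows "\<exists>q\<in>polygon_lengths a b g. \<exists>r\<in>polygon_lengths b c g. p \<le> q + r"
  using assms
proof (induction rule: polygon_lengths_induct)
  case refl
  then have "b = c" by simp
  then show ?case using polygon_lengths_refl[of b g] by (auto intro!: bexI[of _ 0])
next
  case (Cons a d p)
  show ?case
  proof (cases "b \<le> d")
    case True
    have "dist (g a) (g d) + p \<le> dist (g a) (g b) + (dist (g b) (g d) + p)"
      using dist_triangle[of "g a" "g d" "g b"] by simp
    then show ?thesis
      using polygon_lengths_segment[OF Cons.prems(1)] polygon_lengths_Cons[OF True Cons.hyps(2)] by blast
  next
    case False
    then obtain q r where q: "q \<in> polygon_lengths d b g" "r \<in> polygon_lengths b c g" "p \<le> q + r"
      using Cons by auto
    then have "dist (g a) (g d) + p \<le> (dist (g a) (g d) + q) + r" by simp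
    then show ?thesis
      using polygon_lengths_Cons[OF Cons.hyps(1) q(1)] q(2) by blast
  qed
qed

text \<open>Only the first edge of positive parameter length is affected by a small move of the left
  endpoint, and by continuity of \<open>g\<close> it loses at most \<open>e\<close>. This is the
  source of right continuity of the arc length.\<close>

lemma polygon_lengths_shrink_left:
  assumes "p \<in> polygon_lengths a b g" "a < b" "continuous_on {a..b} g" "0 < e"
  shows "\<exists>d>0. \<forall>s. a \<le> s \<and> s < a + d \<and> s \<le> b \<longrightarrow> (\<exists>q\<in>polygon_lengths s b g. p - e \<le> q)"
  using assms
proof (induction rule: polygon_lengths_induct)
  case (Cons a c p)
  show ?case
  proof (cases "a = c")
    case True
    then show ?thesis using Cons by auto
  next
    case False
    have cb: "c \<le> b" using Cons.hyps(2) polygon_lengths_le by blast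
    obtain d where d: "d > 0" "\<And>s. s \<in> {a..b} \<Longrightarrow> dist s a < d \<Longrightarrow> dist (g s) (g a) < e"
      using Cons.prems(1-3) unfolding continuous_on_iff by (metis atLeastAtMost_iff less_imp_le order_refl)
    show ?thesis
    \<comment> \<open>The bound \<open>c - a\<close> keeps \<open>s\<close> before \<open>c\<close>,
      so \<open>c\<close> can remain the second vertex.\<close>
    proof (intro exI[of _ "min d (c - a)"] conjI allI impI)
      show "0 < min d (c - a)" using d(1) False Cons.hyps(1) by simp
      fix s assume s: "a \<le> s \<and> s < a + min d (c - a) \<and> s \<le> b"
      then have "dist (g s) (g a) < e" by (intro d) (auto simp: dist_real_def)
      then have "dist (g a) (g c) + p - e \<le> dist (g s) (g c) + p"
        using dist_triangle[of "g a" "g c" "g s"] by (simp add: dist_commute)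
      then show "\<exists>q\<in>polygon_lengths s b g. dist (g a) (g c) + p - e \<le> q"
        using polygon_lengths_Cons[OF _ Cons.hyps(2), of s] s
        by (intro bexI[of _ "dist (g s) (g c) + p"]) auto
    qed
  qed
qed simp

text \<open>The mirror image, used for left continuity. Since polygons grow at their left end, the
  induction first has to walk along to the last edge of positive parameter length.\<close>

lemma polygon_lengths_shrink_right:
  assumes "p \<in> polygon_lengths a b g" "a < b" "continuous_on {a..b} g" "0 < e"
  shows "\<exists>d>0. \<forall>s. a \<le> s \<and> b - d < s \<and> s \<le> b \<longrightarrow> (\<exists>q\<in>polygon_lengths a s g. p - e \<le> q)"
  using assms
proof (induction rule: polygon_lengths_induct)
  case (Cons a c p)
  have cb: "c \<le> b" using Cons.hyps(2) polygon_lengths_le by blast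
  show ?case
  proof (cases "c = b")
    \<comment> \<open>This edge reaches \<open>b\<close>, so the rest of the polygon contributes 0
      and the edge can be replaced by the one from \<open>a\<close> to \<open>s\<close>.\<close>
    case True
    then have p: "p = 0" using Cons.hyps(2) polygon_lengths_same_endpoints by blast
    obtain d where d: "d > 0" "\<And>s. s \<in> {a..b} \<Longrightarrow> dist s b < d \<Longrightarrow> dist (g s) (g b) < e"
      using Cons.prems(1-3) unfolding continuous_on_iff by (metis atLeastAtMost_iff less_imp_le order_refl)
    show ?thesis
    proof (intro exI[of _ d] conjI allI impI d(1))
      fix s assume s: "a \<le> s \<and> b - d < s \<and> s \<le> b"
      then have "dist (g s) (g b) < e" by (intro d) (auto simp: dist_real_def)
      then have "dist (g a) (g c) + p - e \<le> dist (g a) (g s)"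
        using dist_triangle[of "g a" "g b" "g s"] True p by simp
      then show "\<exists>q\<in>polygon_lengths a s g. dist (g a) (g c) + p - e \<le> q"
        using polygon_lengths_segment[of a s g] s by blast
    qed
  next
    case False
    have "continuous_on {c..b} g"
      using Cons.hyps(1) by (intro continuous_on_subset[OF Cons.prems(2)]) auto
    then obtain d where d: "d > 0"
      "\<And>s. c \<le> s \<Longrightarrow> b - d < s \<Longrightarrow> s \<le> b \<Longrightarrow> \<exists>q\<in>polygon_lengths c s g. p - e \<le> q"
      using Cons False cb by (metis order_le_less)
    show ?thesis
    proof (intro exI[of _ "min d (b - c)"] conjI allI impI)
      show "0 < min d (b - c)" using d(1) False cb by simp
      fix s assume s: "a \<le> s \<and> b - min d (b - c) < s \<and> s \<le> b"
      then have "c \<le> s" "b - d < s" by linarith+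
      then obtain q where "q \<in> polygon_lengths c s g" "p - e \<le> q"
        using d(2)[of s] s by blast
      then show "\<exists>q\<in>polygon_lengths a s g. dist (g a) (g c) + p - e \<le> q"
        using polygon_lengths_Cons[OF Cons.hyps(1)] by (intro bexI[of _ "dist (g a) (g c) + q"]) auto
    qed
  qed
qed simp

section \<open>Arc length of a rectifiable path and the parametrisation by it\<close>

context
  fixes g :: "real \<Rightarrow> 'a::metric_space"
  assumes rectifiable: "rectifiable_path g"
begin

text \<open>Adding the edges from 0 to \<open>s\<close> and from \<open>t\<close> to 1 extends a
  polygon to the whole parameter interval, where rectifiability bounds it.\<close>

lemma bdd_above_polygon_lengths:
  assumes "0 \<le> s" "t \<le> 1"
  shows "bdd_above (polygon_lengths s t g)"
proof -
  obtain B where B: "\<And>p. p \<in> polygon_lengths 0 1 g \<Longrightarrow> p \<le> B"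
    using rectifiable unfolding rectifiable_path_def bdd_above_def by auto
  have "p \<le> B" if p: "p \<in> polygon_lengths s t g" for p
  proof -
    have "dist (g 0) (g s) + (p + dist (g t) (g 1)) \<in> polygon_lengths 0 1 g"
      by (rule polygon_lengths_Cons[OF assms(1) polygon_lengths_append[OF p polygon_lengths_segment[OF assms(2)]]])
    from B[OF this] show ?thesis
      using zero_le_dist[of "g 0" "g s"] zero_le_dist[of "g t" "g 1"] by linarith
  qed
  then show ?thesis unfolding bdd_above_def by blast
qed

text \<open>A polygon over \<open>[s,t]\<close> can be appended to any polygon over
  \<open>[0,s]\<close>. Together with \<open>arc_length_le_add\<close> this replaces additivity of
  length.\<close>

lemma arc_length_add_polygon:
  assumes "0 \<le> s" "t \<le> 1" "p \<in> polygon_lengths s t g"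
  shows "arc_length g s + p \<le> arc_length g t"
proof -
  have "arc_length g s \<le> arc_length g t - p"
    unfolding arc_length_def[of g s]
  proof (rule cSup_least)
    show "polygon_lengths 0 s g \<noteq> {}"
      using polygon_lengths_segment[OF assms(1), of g] by blast
    fix q assume "q \<in> polygon_lengths 0 s g"
    then have "q + p \<in> polygon_lengths 0 t g"
      using assms(3) by (rule polygon_lengths_append)
    then have "q + p \<le> arc_length g t"
      unfolding arc_length_def using assms(2) by (intro cSup_upper bdd_above_polygon_lengths) auto
    then show "q \<le> arc_length g t - p" by simp
  qed
  then show ?thesis by simp
qed

lemma arc_length_le_add:
  assumes "0 \<le> s" "s \<le> t" "t \<le> 1" and B: "\<And>p. p \<in> polygon_lengths s t g \<Longrightarrow> p \<le> B"
  shows "arc_length g t \<le> arc_length g s + B"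
  unfolding arc_length_def[of g t]
proof (rule cSup_least)
  show "polygon_lengths 0 t g \<noteq> {}"
    using polygon_lengths_segment[of 0 t g] assms by fastforce
  fix p assume "p \<in> polygon_lengths 0 t g"
  then obtain q r where "q \<in> polygon_lengths 0 s g" "r \<in> polygon_lengths s t g" "p \<le> q + r"
    using polygon_lengths_split assms(1,2) by blast
  moreover have "q \<le> arc_length g s"
    unfolding arc_length_def using assms \<open>q \<in> _\<close> by (intro cSup_upper bdd_above_polygon_lengths) auto
  ultimately show "p \<le> arc_length g s + B" using B by force
qed

lemma dist_le_arc_length_diff:
  assumes "0 \<le> s" "s \<le> t" "t \<le> 1"
  shows "dist (g s) (g t) \<le> arc_length g t - arc_length g s"
  using arc_length_add_polygon[OF assms(1,3) polygon_lengths_segment[OF assms(2)]] by simp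

lemma arc_length_mono: "0 \<le> s \<Longrightarrow> s \<le> t \<Longrightarrow> t \<le> 1 \<Longrightarrow> arc_length g s \<le> arc_length g t"
  using dist_le_arc_length_diff zero_le_dist by (metis diff_ge_0_iff_ge order_trans)

lemma arc_length_0: "arc_length g 0 = 0"
proof -
  have "polygon_lengths 0 0 g = {0}"
    using polygon_lengths_same_endpoints polygon_lengths_refl by blast
  then show ?thesis by (simp add: arc_length_def)
qed

text \<open>Near-optimal polygons survive a small shortening of their interval. On the left of
  \<open>t\<close> this leaves \<open>arc_length g s\<close> close to \<open>arc_length g t\<close>;
  on the right, a near-optimal polygon over \<open>[s,1]\<close> leaves little length for
  \<open>[t,s]\<close>.\<close>

lemma continuous_on_arc_length: "continuous_on {0..1} (arc_length g)"
  unfolding continuous_on_iff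
proof (intro ballI allI impI)
  have cont: "continuous_on {0..1} g"
    using rectifiable by (simp add: rectifiable_path_def path_def)
  fix t e :: real assume t: "t \<in> {0..1}" and e: "0 < e"
  have left: "\<exists>d>0. \<forall>s. 0 \<le> s \<and> t - d < s \<and> s \<le> t \<longrightarrow> arc_length g t - arc_length g s < e"
  proof (cases "t = 0")
    case True
    then show ?thesis using e by (intro exI[of _ 1]) auto
  next
    case False
    have "polygon_lengths 0 t g \<noteq> {}"
      using polygon_lengths_segment[of 0 t g] t by fastforce
    then obtain p where p: "p \<in> polygon_lengths 0 t g" "arc_length g t - e / 2 < p"
      using less_cSup_iff[OF _ bdd_above_polygon_lengths, of 0 t "arc_length g t - e / 2"] t e
      by (auto simp: arc_length_def)
    have "continuous_on {0..t} g" using cont by (rule continuous_on_subset) (use t in auto)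
    then obtain d where d: "d > 0"
      "\<And>s. 0 \<le> s \<Longrightarrow> t - d < s \<Longrightarrow> s \<le> t \<Longrightarrow> \<exists>q\<in>polygon_lengths 0 s g. p - e / 2 \<le> q"
      using polygon_lengths_shrink_right[OF p(1), of "e / 2"] False t e by auto
    have "arc_length g t - arc_length g s < e" if s: "0 \<le> s" "t - d < s" "s \<le> t" for s
    proof -
      obtain q where q: "q \<in> polygon_lengths 0 s g" "p - e / 2 \<le> q" using d(2) s by blast
      then have "q \<le> arc_length g s"
        using arc_length_add_polygon[of 0 s q] s t arc_length_0 by simp
      then show ?thesis using p q by linarith
    qed
    then show ?thesis using d(1) by blast
  qed
  have right: "\<exists>d>0. \<forall>s. t \<le> s \<and> s < t + d \<and> s \<le> 1 \<longrightarrow> arc_length g s - arc_length g t < e"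
  proof (cases "t = 1")
    case True
    then show ?thesis using e by (intro exI[of _ 1]) auto
  next
    case False
    have ne: "polygon_lengths t 1 g \<noteq> {}"
      using polygon_lengths_segment[of t 1 g] t by fastforce
    obtain p where p: "p \<in> polygon_lengths t 1 g" "Sup (polygon_lengths t 1 g) - e / 3 < p"
      using less_cSup_iff[OF ne bdd_above_polygon_lengths, of "Sup (polygon_lengths t 1 g) - e / 3"] t e
      by auto
    have "continuous_on {t..1} g" using cont by (rule continuous_on_subset) (use t in auto)
    then obtain d where d: "d > 0"
      "\<And>s. t \<le> s \<Longrightarrow> s < t + d \<Longrightarrow> s \<le> 1 \<Longrightarrow> \<exists>q\<in>polygon_lengths s 1 g. p - e / 3 \<le> q"
      using polygon_lengths_shrink_left[OF p(1), of "e / 3"] False t e by auto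
    have "arc_length g s - arc_length g t < e" if s: "t \<le> s" "s < t + d" "s \<le> 1" for s
    proof -
      obtain q where q: "q \<in> polygon_lengths s 1 g" "p - e / 3 \<le> q" using d(2) s by blast
      \<comment> \<open>A polygon over \<open>[t,s]\<close> joined to \<open>q\<close> cannot exceed
        the supremum over \<open>[t,1]\<close>. One third of \<open>e\<close> is lost in choosing
        \<open>p\<close>, another in passing from \<open>p\<close> to \<open>q\<close>.\<close>
      have "arc_length g s \<le> arc_length g t + 2 * e / 3"
      proof (rule arc_length_le_add)
        fix r assume "r \<in> polygon_lengths t s g"
        then have "r + q \<in> polygon_lengths t 1 g" using q(1) by (rule polygon_lengths_append)
        then have "r + q \<le> Sup (polygon_lengths t 1 g)"
          using t by (intro cSup_upper bdd_above_polygon_lengths) auto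
        then show "r \<le> 2 * e / 3" using p q by (simp add: field_simps)
      qed (use s t in auto)
      then show ?thesis using e by simp
    qed
    then show ?thesis using d(1) by blast
  qed
  obtain d1 d2 where d: "d1 > 0" "d2 > 0"
    "\<And>s. 0 \<le> s \<Longrightarrow> t - d1 < s \<Longrightarrow> s \<le> t \<Longrightarrow> arc_length g t - arc_length g s < e"
    "\<And>s. t \<le> s \<Longrightarrow> s < t + d2 \<Longrightarrow> s \<le> 1 \<Longrightarrow> arc_length g s - arc_length g t < e"
    using left right by blast
  show "\<exists>d>0. \<forall>s\<in>{0..1}. dist s t < d \<longrightarrow> dist (arc_length g s) (arc_length g t) < e"
  proof (intro exI[of _ "min d1 d2"] conjI ballI impI)
    show "0 < min d1 d2" using d by simp
    fix s assume s: "s \<in> {0..1}" "dist s t < min d1 d2"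
    show "dist (arc_length g s) (arc_length g t) < e"
    proof (cases "s \<le> t")
      case True
      then show ?thesis
        using d(3)[of s] arc_length_mono[of s t] s t by (simp add: dist_real_def)
    next
      case False
      then show ?thesis
        using d(4)[of s] arc_length_mono[of t s] s t by (simp add: dist_real_def)
    qed
  qed
qed

lemma arc_length_image: "arc_length g ` {0..1} = {0..arc_length g 1}"
proof
  show "arc_length g ` {0..1} \<subseteq> {0..arc_length g 1}"
    using arc_length_mono[of 0] arc_length_mono[of _ 1] arc_length_0 by auto
  show "{0..arc_length g 1} \<subseteq> arc_length g ` {0..1}"
  proof
    fix u assume "u \<in> {0..arc_length g 1}"
    then show "u \<in> arc_length g ` {0..1}"
      using IVT'[of "arc_length g" 0 u 1] continuous_on_arc_length arc_length_0 by auto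
  qed
qed

lemma dist_le_abs_arc_length_diff:
  assumes "s \<in> {0..1}" "t \<in> {0..1}"
  shows "dist (g s) (g t) \<le> \<bar>arc_length g s - arc_length g t\<bar>"
  using dist_le_arc_length_diff[of s t] dist_le_arc_length_diff[of t s] assms
  by (cases "s \<le> t") (auto simp: dist_commute)

text \<open>The preimage chosen by \<open>inv_into\<close> may differ from \<open>t\<close>, but it
  has the same arc length, and chords are bounded by differences of arc length.\<close>

lemma arc_length_param_arc_length:
  assumes "t \<in> {0..1}"
  shows "arc_length_param g (arc_length g t) = g t"
proof -
  have "arc_length g t \<in> arc_length g ` {0..1}" using assms by blast
  then have "inv_into {0..1} (arc_length g) (arc_length g t) \<in> {0..1}"
    and "arc_length g (inv_into {0..1} (arc_length g) (arc_length g t)) = arc_length g t"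
    by (rule inv_into_into, rule f_inv_into_f)
  then show ?thesis
    using dist_le_abs_arc_length_diff[of "inv_into {0..1} (arc_length g) (arc_length g t)" t] assms
    by (simp add: arc_length_param_def)
qed

lemma arc_length_param_in_path_image:
  assumes "u \<in> {0..arc_length g 1}"
  shows "arc_length_param g u \<in> path_image g"
  using assms arc_length_image arc_length_param_arc_length
  unfolding path_image_def by (metis (no_types, lifting) image_iff)

text \<open>The 1-Lipschitz property controls how fast the distance to the boundary can change along
  the path.\<close>

lemma dist_arc_length_param_le:
  assumes "u \<in> {0..arc_length g 1}" "v \<in> {0..arc_length g 1}"
  shows "dist (arc_length_param g u) (arc_length_param g v) \<le> \<bar>u - v\<bar>"
proof -
  obtain s t where "s \<in> {0..1}" "t \<in> {0..1}" "u = arc_length g s" "v = arc_length g t"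
    using assms arc_length_image by (metis (no_types, lifting) image_iff)
  then show ?thesis
    using dist_le_abs_arc_length_diff[of s t] by (simp add: arc_length_param_arc_length)
qed

lemma continuous_on_arc_length_param: "continuous_on {0..arc_length g 1} (arc_length_param g)"
  unfolding continuous_on_iff
proof (intro ballI allI impI)
  fix u e :: real assume u: "u \<in> {0..arc_length g 1}" and e: "0 < e"
  show "\<exists>d>0. \<forall>v\<in>{0..arc_length g 1}. dist v u < d \<longrightarrow> dist (arc_length_param g v) (arc_length_param g u) < e"
    using dist_arc_length_param_le[OF _ u] e by (intro exI[of _ e]) (fastforce simp: dist_real_def)
qed

lemma continuous_on_comp_arc_length_param:
  assumes "continuous_on (path_image g) \<rho>"
  shows "continuous_on {0..arc_length g 1} (\<lambda>u. \<rho> (arc_length_param g u))"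
  by (rule continuous_on_compose2[OF assms continuous_on_arc_length_param])
     (use arc_length_param_in_path_image in blast)

end

subsection \<open>Line integrals along smooth paths\<close>

context
  fixes g g' :: "real \<Rightarrow> 'a::real_normed_vector"
  assumes deriv: "\<And>t. t \<in> {0..1} \<Longrightarrow> (g has_vector_derivative g' t) (at t within {0..1})"
    and cont_speed: "continuous_on {0..1} (\<lambda>t. norm (g' t))"
begin

abbreviation (input) travelled :: "real \<Rightarrow> real" where
  "travelled u \<equiv> integral {0..u} (\<lambda>t. norm (g' t))"

lemma travelled_has_derivative:
  "t \<in> {0..1} \<Longrightarrow> (travelled has_real_derivative norm (g' t)) (at t within {0..1})"
  using integral_has_real_derivative[OF cont_speed] .

lemma continuous_on_smooth_path: "continuous_on {0..1} g"
  using deriv has_vector_derivative_continuous continuous_on_eq_continuous_within by blast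

text \<open>This is the mean value inequality, with the integrated speed as the dominating real
  function.\<close>

lemma dist_le_travelled_diff:
  assumes "0 \<le> s" "s \<le> t" "t \<le> 1"
  shows "dist (g s) (g t) \<le> travelled t - travelled s"
proof (cases "s = t")
  case False
  have sub: "{s..t} \<subseteq> {0..1}" using assms by auto
  \<comment> \<open>The mean value inequality asks for two-sided derivatives at interior
    points.\<close>
  have at: "at u within {0..1} = at u" if "s < u" "u < t" for u :: real
    using that assms by (intro at_within_Icc_at) auto
  have "norm (g t - g s) \<le> travelled t - travelled s"
  proof (rule differentiable_bound_general[where f' = g' and \<phi>' = "\<lambda>t. norm (g' t)"])
    show "s < t" using False assms by simp
    show "continuous_on {s..t} g"
      using continuous_on_smooth_path sub continuous_on_subset by blast
    show "continuous_on {s..t} travelled"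
      using travelled_has_derivative sub
      by (meson DERIV_continuous continuous_on_eq_continuous_within continuous_on_subset)
    fix u assume u: "s < u" "u < t"
    then have "u \<in> {0..1}" using assms by auto
    then show "(g has_vector_derivative g' u) (at u)"
      and "(travelled has_vector_derivative norm (g' u)) (at u)"
      using deriv travelled_has_derivative at[OF u]
      by (metis, metis has_real_derivative_iff_has_vector_derivative)
  qed simp
  then show ?thesis by (simp add: dist_norm norm_minus_commute)
qed simp

lemma polygon_lengths_le_travelled_diff:
  assumes "p \<in> polygon_lengths s t g" "0 \<le> s" "t \<le> 1"
  shows "p \<le> travelled t - travelled s"
  using assms
proof (induction rule: polygon_lengths_induct)
  case (Cons a c p)
  then have "c \<le> t" using polygon_lengths_le by blast
  then show ?case
    using Cons dist_le_travelled_diff[of a c] by (force intro: order_trans)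
qed simp

lemma rectifiable_smooth_path: "rectifiable_path g"
  unfolding rectifiable_path_def path_def bdd_above_def
  using continuous_on_smooth_path polygon_lengths_le_travelled_diff by blast

lemma arc_length_diff_le_travelled_diff:
  assumes "0 \<le> s" "s \<le> t" "t \<le> 1"
  shows "arc_length g t - arc_length g s \<le> travelled t - travelled s"
proof -
  have "arc_length g t \<le> arc_length g s + (travelled t - travelled s)"
    using assms polygon_lengths_le_travelled_diff
    by (intro arc_length_le_add[OF rectifiable_smooth_path]) auto
  then show ?thesis by simp
qed

text \<open>By the reverse triangle inequality, the error is at most the normalised remainder in the
  definition of the derivative.\<close>

lemma tendsto_chord_quotient:
  assumes "t \<in> {0..1}"
  shows "((\<lambda>y. dist (g y) (g t) / \<bar>y - t\<bar>) \<longlongrightarrow> norm (g' t)) (at t within {0..1})"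
proof -
  have "((\<lambda>y. (1 / norm (y - t)) *\<^sub>R (g y - (g t + (y - t) *\<^sub>R g' t))) \<longlongrightarrow> 0) (at t within {0..1})"
    using deriv[OF assms] unfolding has_vector_derivative_def has_derivative_within by blast
  then have *: "((\<lambda>y. norm ((1 / norm (y - t)) *\<^sub>R (g y - (g t + (y - t) *\<^sub>R g' t)))) \<longlongrightarrow> 0) (at t within {0..1})"
    by (rule tendsto_norm_zero)
  have "((\<lambda>y. dist (g y) (g t) / \<bar>y - t\<bar> - norm (g' t)) \<longlongrightarrow> 0) (at t within {0..1})"
  proof (rule Lim_null_comparison[OF _ *])
    show "\<forall>\<^sub>F y in at t within {0..1}. norm (dist (g y) (g t) / \<bar>y - t\<bar> - norm (g' t))
      \<le> norm ((1 / norm (y - t)) *\<^sub>R (g y - (g t + (y - t) *\<^sub>R g' t)))"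
      unfolding eventually_at_filter
    proof (intro always_eventually allI impI)
      fix y assume y: "y \<noteq> t"
      have "\<bar>norm (g y - g t) - norm ((y - t) *\<^sub>R g' t)\<bar> \<le> norm ((g y - g t) - (y - t) *\<^sub>R g' t)"
        by (rule norm_triangle_ineq3)
      then have "\<bar>norm (g y - g t) - \<bar>y - t\<bar> * norm (g' t)\<bar> \<le> norm (g y - (g t + (y - t) *\<^sub>R g' t))"
        by (simp add: diff_diff_eq)
      then have "\<bar>norm (g y - g t) - \<bar>y - t\<bar> * norm (g' t)\<bar> / \<bar>y - t\<bar>
          \<le> norm (g y - (g t + (y - t) *\<^sub>R g' t)) / \<bar>y - t\<bar>"
        by (intro divide_right_mono) auto
      moreover have "norm (g y - g t) / \<bar>y - t\<bar> - norm (g' t)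
          = (norm (g y - g t) - \<bar>y - t\<bar> * norm (g' t)) / \<bar>y - t\<bar>"
        using y by (simp add: field_simps)
      ultimately show "norm (dist (g y) (g t) / \<bar>y - t\<bar> - norm (g' t))
          \<le> norm ((1 / norm (y - t)) *\<^sub>R (g y - (g t + (y - t) *\<^sub>R g' t)))"
        by (simp add: dist_norm)
    qed
  qed
  then show ?thesis by (rule LIM_zero_cancel)
qed

text \<open>
  Difference quotients of the arc length lie between chord quotients and those of the integrated
  speed, and both bounds tend to the speed.
\<close>

lemma arc_length_has_derivative:
  assumes t: "t \<in> {0..1}"
  shows "(arc_length g has_real_derivative norm (g' t)) (at t within {0..1})"
  unfolding has_field_derivative_iff
proof (rule tendsto_sandwich[OF _ _ tendsto_chord_quotient[OF t]
      travelled_has_derivative[OF t, unfolded has_field_derivative_iff]])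
  \<comment> \<open>For \<open>y < t\<close> both signs are flipped, because the length bounds are
    stated for ordered parameters.\<close>
  have eq: "(u - v) / (y - t) = (v - u) / (t - y)" for u v y :: real
    by (simp add: minus_divide_divide[symmetric, of "u - v"])
  have "dist (g y) (g t) / \<bar>y - t\<bar> \<le> (arc_length g y - arc_length g t) / (y - t) \<and>
        (arc_length g y - arc_length g t) / (y - t) \<le> (travelled y - travelled t) / (y - t)"
    if y: "y \<in> {0..1}" "y \<noteq> t" for y
  proof (cases "t < y")
    case True
    then show ?thesis
      using dist_le_arc_length_diff[OF rectifiable_smooth_path, of t y]
        arc_length_diff_le_travelled_diff[of t y] t y
      by (auto simp: dist_commute intro!: divide_right_mono)
  next
    case False
    then have "y < t" using y by simp
    then show ?thesis
      using dist_le_arc_length_diff[OF rectifiable_smooth_path, of y t]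
        arc_length_diff_le_travelled_diff[of y t] t y
      unfolding eq[of "arc_length g y"] eq[of "travelled y"]
      by (auto intro!: divide_right_mono)
  qed
  then show "\<forall>\<^sub>F y in at t within {0..1}. dist (g y) (g t) / \<bar>y - t\<bar> \<le> (arc_length g y - arc_length g t) / (y - t)"
    and "\<forall>\<^sub>F y in at t within {0..1}. (arc_length g y - arc_length g t) / (y - t) \<le> (travelled y - travelled t) / (y - t)"
    by (auto simp: eventually_at_filter)
qed

text \<open>The substitution \<open>u = arc_length g t\<close> is carried out on antiderivatives, by
  the chain rule and the fundamental theorem of calculus. It therefore also covers points where the
  speed vanishes and arc length is not injective.\<close>

lemma line_integral_smooth_path:
  assumes \<rho>: "continuous_on (path_image g) \<rho>"
  shows "((\<lambda>t. \<rho> (g t) * norm (g' t)) has_integral line_integral g \<rho>) {0..1}"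
proof -
  let ?f = "\<lambda>u. \<rho> (arc_length_param g u)"
  let ?H = "\<lambda>v. integral {0..v} ?f"
  note rect = rectifiable_smooth_path
  have "(?H \<circ> arc_length g has_real_derivative \<rho> (g t) * norm (g' t)) (at t within {0..1})"
    if t: "t \<in> {0..1}" for t
  proof (rule DERIV_image_chain[OF _ arc_length_has_derivative[OF t]])
    have "arc_length g t \<in> {0..arc_length g 1}"
      using t arc_length_image[OF rect] by blast
    then show "(?H has_real_derivative \<rho> (g t)) (at (arc_length g t) within arc_length g ` {0..1})"
      using integral_has_real_derivative[OF continuous_on_comp_arc_length_param[OF rect \<rho>]]
      by (metis arc_length_image[OF rect] arc_length_param_arc_length[OF rect t])
  qed
  then have "((\<lambda>t. \<rho> (g t) * norm (g' t)) has_integral (?H \<circ> arc_length g) 1 - (?H \<circ> arc_length g) 0) {0..1}"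
    by (intro fundamental_theorem_of_calculus) (simp_all add: o_def flip: has_real_derivative_iff_has_vector_derivative)
  then show ?thesis
    by (simp add: line_integral_def arc_length_0[OF rect])
qed

end

subsection \<open>Distance to the boundary\<close>

lemma bdist_pos:
  assumes "open G" "frontier G \<noteq> {}" "z \<in> G"
  shows "0 < bdist G z"
proof -
  have "z \<notin> frontier G" using assms by (simp add: frontier_def interior_open)
  then show ?thesis
    unfolding bdist_def using assms(2) by (simp add: infdist_pos_not_in_closed)
qed

lemma continuous_on_bdist: "continuous_on S (bdist G)"
  unfolding bdist_def by (intro continuous_intros)

lemma continuous_on_inverse_bdist:
  assumes "open G" "frontier G \<noteq> {}" "S \<subseteq> G"
  shows "continuous_on S (\<lambda>z. 1 / bdist G z)"
  using bdist_pos[OF assms(1,2)] assms(3)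
  by (intro continuous_intros continuous_on_bdist) (metis less_irrefl subsetD)

text \<open>In the non-integrable case \<open>integral\<close> has the default value 0. The bound
  makes 0 a lower bound of the set whose \<open>Inf\<close> defines the quasihyperbolic
  metric.\<close>

lemma line_integral_inverse_bdist_nonneg: "0 \<le> line_integral g (\<lambda>z. 1 / bdist G z)"
  unfolding line_integral_def
proof (cases "(\<lambda>u. 1 / bdist G (arc_length_param g u)) integrable_on {0..arc_length g 1}")
  case True
  then show "0 \<le> integral {0..arc_length g 1} (\<lambda>u. 1 / bdist G (arc_length_param g u))"
    by (rule integral_nonneg) (simp add: bdist_def infdist_nonneg)
qed (simp add: not_integrable_integral)

section \<open>Bounds for the quasihyperbolic metric from individual paths\<close>

lemma quasihyperbolic_metric_le_line_integral:
  assumes "rectifiable_path g" "path_image g \<subseteq> G" "pathstart g = x" "pathfinish g = y"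
  shows "quasihyperbolic_metric G x y \<le> line_integral g (\<lambda>z. 1 / bdist G z)"
  unfolding quasihyperbolic_metric_def
  by (rule cInf_lower) (use assms line_integral_inverse_bdist_nonneg in \<open>auto intro!: bdd_belowI[of _ 0]\<close>)

text \<open>Both upper bounds come from here: an explicit smooth competitor, and a majorant
  \<open>\<phi>\<close> of its integrand with a known integral.\<close>

lemma quasihyperbolic_metric_le_smooth:
  assumes G: "open G" "frontier G \<noteq> {}"
    and deriv: "\<And>t. t \<in> {0..1} \<Longrightarrow> (g has_vector_derivative g' t) (at t within {0..1})"
    and speed: "continuous_on {0..1} (\<lambda>t. norm (g' t))"
    and g: "\<And>t. t \<in> {0..1} \<Longrightarrow> g t \<in> G" "g 0 = x" "g 1 = y"
    and bound: "(\<phi> has_integral I) {0..1}"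
      "\<And>t. t \<in> {0..1} \<Longrightarrow> norm (g' t) / bdist G (g t) \<le> \<phi> t"
  shows "quasihyperbolic_metric G x y \<le> I"
proof -
  have img: "path_image g \<subseteq> G" using g(1) by (auto simp: path_image_def)
  have "quasihyperbolic_metric G x y \<le> line_integral g (\<lambda>z. 1 / bdist G z)"
    using rectifiable_smooth_path[OF deriv speed] img g(2,3)
    by (intro quasihyperbolic_metric_le_line_integral) (auto simp: pathstart_def pathfinish_def)
  also have "\<dots> \<le> I"
    by (rule has_integral_le[OF line_integral_smooth_path[OF deriv speed
          continuous_on_inverse_bdist[OF G img]] bound(1)]) (use bound(2) in auto)
  finally show ?thesis .
qed

text \<open>The minimum in the distance ratio metric may be attained at either endpoint, so the
  growth estimate for the boundary distance is run from both ends: it is at most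
  \<open>a + u\<close> and at most \<open>b + L - u\<close>.\<close>

lemma distance_ratio_metric_le_line_integral:
  assumes G: "open G" "frontier G \<noteq> {}" and g: "rectifiable_path g" "path_image g \<subseteq> G"
  shows "distance_ratio_metric G (pathstart g) (pathfinish g) \<le> line_integral g (\<lambda>z. 1 / bdist G z)"
proof -
  define L where "L = arc_length g 1"
  define f where "f = arc_length_param g"
  define a where "a = bdist G (pathstart g)"
  define b where "b = bdist G (pathfinish g)"
  have L: "0 \<le> L" "dist (pathstart g) (pathfinish g) \<le> L"
    using arc_length_mono[OF g(1), of 0 1] dist_le_arc_length_diff[OF g(1), of 0 1]
      arc_length_0[OF g(1)] by (auto simp: L_def pathstart_def pathfinish_def)
  have f0: "f 0 = pathstart g" and fL: "f L = pathfinish g"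
    using arc_length_param_arc_length[OF g(1), of 0] arc_length_param_arc_length[OF g(1), of 1]
      arc_length_0[OF g(1)] by (auto simp: f_def L_def pathstart_def pathfinish_def)
  have lip: "dist (f u) (f v) \<le> \<bar>u - v\<bar>" if "u \<in> {0..L}" "v \<in> {0..L}" for u v
    using dist_arc_length_param_le[OF g(1)] that by (simp add: f_def L_def)
  have fG: "f u \<in> G" if "u \<in> {0..L}" for u
    using arc_length_param_in_path_image[OF g(1)] g(2) that by (auto simp: f_def L_def)
  have pos: "0 < bdist G (f u)" if "u \<in> {0..L}" for u
    using bdist_pos[OF G fG[OF that]] .
  have ab: "0 < a" "0 < b" using pos[of 0] pos[of L] L by (auto simp: a_def b_def f0 fL)
  have int: "((\<lambda>u. 1 / bdist G (f u)) has_integral line_integral g (\<lambda>z. 1 / bdist G z)) {0..L}"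
    using continuous_on_comp_arc_length_param[OF g(1) continuous_on_inverse_bdist[OF G g(2)]]
    unfolding line_integral_def f_def L_def
    by (intro integrable_integral integrable_continuous_interval)
  have bd: "bdist G (f u) \<le> bdist G (f v) + \<bar>u - v\<bar>" if "u \<in> {0..L}" "v \<in> {0..L}" for u v
    using infdist_triangle[of "f u" "frontier G" "f v"] lip[OF that] by (simp add: bdist_def)
  have "((\<lambda>u. 1 / (a + u)) has_integral ln (a + L) - ln (a + 0)) {0..L}"
    using L ab by (intro fundamental_theorem_of_calculus)
      (auto simp flip: has_real_derivative_iff_has_vector_derivative intro!: derivative_eq_intros)
  then have "ln (a + L) - ln (a + 0) \<le> line_integral g (\<lambda>z. 1 / bdist G z)"
    using int by (rule has_integral_le)
      (use bd[of _ 0] pos L in \<open>auto simp: a_def f0 intro!: divide_left_mono mult_pos_pos add_pos_nonneg ab[unfolded a_def]\<close>)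
  moreover have "((\<lambda>u. 1 / (b + L - u)) has_integral - ln (b + L - L) - - ln (b + L - 0)) {0..L}"
    using L ab by (intro fundamental_theorem_of_calculus)
      (auto simp flip: has_real_derivative_iff_has_vector_derivative intro!: derivative_eq_intros)
  then have "- ln (b + L - L) - - ln (b + L - 0) \<le> line_integral g (\<lambda>z. 1 / bdist G z)"
    using int
  proof (rule has_integral_le)
    fix u assume u: "u \<in> {0..L}"
    then have "bdist G (f u) \<le> b + L - u" using bd[OF u, of L] by (auto simp: b_def fL)
    then show "1 / (b + L - u) \<le> 1 / bdist G (f u)"
      using pos[OF u] by (simp add: frac_le)
  qed
  \<comment> \<open>Used with \<open>c = a\<close> or \<open>c = b\<close>, whichever is the
    minimum; the chord is no longer than \<open>L\<close>.\<close>
  moreover have "ln (1 + dist (pathstart g) (pathfinish g) / c) \<le> ln (c + L) - ln c" if "0 < c" for c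
  proof -
    have "1 + dist (pathstart g) (pathfinish g) / c \<le> (c + L) / c"
      using L that by (simp add: field_simps)
    then have "ln (1 + dist (pathstart g) (pathfinish g) / c) \<le> ln ((c + L) / c)"
      using that by (subst ln_le_cancel_iff) (auto intro!: add_pos_nonneg divide_pos_pos L)
    then show ?thesis using that L by (simp add: ln_div)
  qed
  ultimately show ?thesis
    using ab unfolding distance_ratio_metric_def a_def[symmetric] b_def[symmetric]
    by (smt (verit, best) min_def)
qed

text \<open>The distance to \<open>w0\<close> gives the upper bound. The triangle inequality at
  \<open>w\<close> gives the matching lower bound, as the two distances along the segment add up to
  \<open>bdist G w\<close>.\<close>

lemma bdist_radial:
  fixes G :: "'a::real_normed_vector set"
  assumes "w0 \<in> frontier G" "dist w w0 = bdist G w" "0 \<le> c" "c \<le> 1"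
  shows "bdist G (w + c *\<^sub>R (w0 - w)) = (1 - c) * bdist G w"
proof (rule antisym)
  have "w + c *\<^sub>R (w0 - w) - w0 = (1 - c) *\<^sub>R (w - w0)"
    by (simp add: algebra_simps)
  then have "dist (w + c *\<^sub>R (w0 - w)) w0 = (1 - c) * dist w w0"
    using assms(4) by (simp add: dist_norm)
  then show "bdist G (w + c *\<^sub>R (w0 - w)) \<le> (1 - c) * bdist G w"
    using infdist_le[OF assms(1), of "w + c *\<^sub>R (w0 - w)"] assms(2) by (simp add: bdist_def)
  have "dist w (w + c *\<^sub>R (w0 - w)) = c * bdist G w"
    using assms(2,3) by (simp add: dist_norm norm_minus_commute)
  then show "(1 - c) * bdist G w \<le> bdist G (w + c *\<^sub>R (w0 - w))"
    using infdist_triangle[of w "frontier G" "w + c *\<^sub>R (w0 - w)"] by (simp add: bdist_def algebra_simps)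
qed

text \<open>The competitor is the segment itself, on which the boundary distance is
  \<open>(1 - c t) * d\<close>. Its integral is a difference of logarithms and matches the distance
  ratio metric exactly.\<close>

lemma quasihyperbolic_metric_le_radial:
  fixes G :: "'a::real_normed_vector set"
  assumes G: "open G" and w0: "w0 \<in> frontier G" "dist w w0 = bdist G w" and d: "0 < bdist G w"
    and a: "0 \<le> a" "a < 1" and b: "0 \<le> b" "b < 1"
    and inG: "\<And>c. 0 \<le> c \<Longrightarrow> c < 1 \<Longrightarrow> w + c *\<^sub>R (w0 - w) \<in> G"
  shows "quasihyperbolic_metric G (w + a *\<^sub>R (w0 - w)) (w + b *\<^sub>R (w0 - w))
       \<le> distance_ratio_metric G (w + a *\<^sub>R (w0 - w)) (w + b *\<^sub>R (w0 - w))"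
proof -
  define d where "d = bdist G w"
  define c where "c t = (1 - t) * a + t * b" for t
  have nd: "norm (w0 - w) = d" using w0(2) by (simp add: d_def dist_norm norm_minus_commute)
  have d0: "0 < d" using assms(4) by (simp add: d_def)
  have c: "0 \<le> c t" "c t < 1" if "t \<in> {0..1}" for t
  proof -
    show "0 \<le> c t" using that a b by (simp add: c_def)
    have "c t \<le> max a b"
      using convex_bound_le[of a "max a b" b "1 - t" t] that by (simp add: c_def)
    then show "c t < 1" using a b by simp
  qed
  have "quasihyperbolic_metric G (w + a *\<^sub>R (w0 - w)) (w + b *\<^sub>R (w0 - w)) \<le> \<bar>ln (1 - b) - ln (1 - a)\<bar>"
  proof (rule quasihyperbolic_metric_le_smooth[where g = "\<lambda>t. w + c t *\<^sub>R (w0 - w)"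
        and g' = "\<lambda>t. (b - a) *\<^sub>R (w0 - w)" and \<phi> = "\<lambda>t. \<bar>b - a\<bar> / (1 - c t)"])
    show "((\<lambda>t. w + c t *\<^sub>R (w0 - w)) has_vector_derivative (b - a) *\<^sub>R (w0 - w)) (at t within {0..1})" for t
      unfolding c_def by (auto intro!: derivative_eq_intros simp: algebra_simps)
    have "((\<lambda>t. - ln (1 - c t)) has_real_derivative (b - a) / (1 - c t)) (at t within {0..1})"
      if "t \<in> {0..1}" for t
    proof -
      have "(c has_real_derivative b - a) (at t within {0..1})"
        unfolding c_def by (auto intro!: derivative_eq_intros)
      then show ?thesis
        using c(2)[OF that] by (auto intro!: derivative_eq_intros simp: field_simps)
    qed
    \<comment> \<open>The factor \<open>sgn (b - a)\<close> treats both orders of \<open>a\<close>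
      and \<open>b\<close> at once.\<close>
    then have "((\<lambda>t. sgn (b - a) * ((b - a) / (1 - c t)))
        has_integral sgn (b - a) * (- ln (1 - c 1) - - ln (1 - c 0))) {0..1}"
      by (intro has_integral_mult_right fundamental_theorem_of_calculus)
        (simp_all flip: has_real_derivative_iff_has_vector_derivative)
    moreover have "sgn (b - a) * (- ln (1 - c 1) - - ln (1 - c 0)) = \<bar>ln (1 - b) - ln (1 - a)\<bar>"
      using a b by (auto simp: c_def sgn_if abs_if)
    ultimately show "((\<lambda>t. \<bar>b - a\<bar> / (1 - c t)) has_integral \<bar>ln (1 - b) - ln (1 - a)\<bar>) {0..1}"
      by (simp add: sgn_if abs_if split: if_splits)
    fix t :: real assume t: "t \<in> {0..1}"
    show "norm ((b - a) *\<^sub>R (w0 - w)) / bdist G (w + c t *\<^sub>R (w0 - w)) \<le> \<bar>b - a\<bar> / (1 - c t)"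
      using c[OF t] d0 bdist_radial[OF w0, of "c t"] by (simp add: nd flip: d_def)
    show "w + c t *\<^sub>R (w0 - w) \<in> G" using inG c[OF t] by blast
  qed (use G w0 in \<open>auto simp: c_def\<close>)
  also have "\<dots> = ln (1 + \<bar>a - b\<bar> / min (1 - a) (1 - b))"
  proof -
    have "1 + \<bar>a - b\<bar> / min (1 - a) (1 - b) = max (1 - a) (1 - b) / min (1 - a) (1 - b)"
      using a b by (auto simp: field_simps min_def max_def)
    moreover have "max (1 - a) (1 - b) \<noteq> 0" "min (1 - a) (1 - b) \<noteq> 0"
      using a b by (auto simp: max_def min_def)
    ultimately have "ln (1 + \<bar>a - b\<bar> / min (1 - a) (1 - b)) = ln (max (1 - a) (1 - b)) - ln (min (1 - a) (1 - b))"
      by (simp only: ln_div simp_thms if_True)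
    then show ?thesis using a b by (auto simp: min_def max_def abs_if)
  qed
  also have "\<dots> = distance_ratio_metric G (w + a *\<^sub>R (w0 - w)) (w + b *\<^sub>R (w0 - w))"
  proof -
    have "min ((1 - a) * d) ((1 - b) * d) = min (1 - a) (1 - b) * d"
      using d0 by (auto simp: min_def)
    moreover have "dist (w + a *\<^sub>R (w0 - w)) (w + b *\<^sub>R (w0 - w)) = \<bar>a - b\<bar> * d"
      by (simp add: dist_norm nd flip: scaleR_diff_left)
    ultimately have "distance_ratio_metric G (w + a *\<^sub>R (w0 - w)) (w + b *\<^sub>R (w0 - w))
        = ln (1 + \<bar>a - b\<bar> * d / (min (1 - a) (1 - b) * d))"
      using bdist_radial[OF w0, of a] bdist_radial[OF w0, of b] a b
      by (simp only: distance_ratio_metric_def less_imp_le flip: d_def)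
    then show ?thesis using d0 by simp
  qed
  finally show ?thesis .
qed

text \<open>Every point of the ball lies on a radius, and every unit vector is a boundary point
  nearest to the centre, so \<open>bdist_radial\<close> applies; for \<open>z = 0\<close> any radius
  will do.\<close>

lemma bdist_ball:
  fixes z :: "'a::euclidean_space"
  assumes "norm z < 1"
  shows "bdist (ball 0 1) z = 1 - norm z"
proof -
  have center: "bdist (ball 0 1) (0::'a) = 1"
  proof (rule antisym)
    obtain e :: 'a where e: "norm e = 1" using vector_choose_size[of 1] by auto
    then show "bdist (ball 0 1) (0::'a) \<le> 1"
      using infdist_le[of e "sphere 0 1" 0] by (simp add: bdist_def)
    have "sphere (0::'a) 1 \<noteq> {}" using e by auto
    then show "1 \<le> bdist (ball 0 1) (0::'a)"
      by (auto simp: bdist_def infdist_notempty intro!: cINF_greatest)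
  qed
  obtain e :: 'a where e: "norm e = 1" "z = norm z *\<^sub>R e"
  proof (cases "z = 0")
    case True
    obtain e :: 'a where "norm e = 1" using vector_choose_size[of 1] by auto
    then show ?thesis using that[of e] True by simp
  next
    case False
    then have "norm (sgn z) = 1" by (simp add: norm_sgn)
    moreover have "z = norm z *\<^sub>R sgn z" using False by (simp add: sgn_div_norm)
    ultimately show ?thesis by (rule that)
  qed
  show ?thesis
    using bdist_radial[of e "ball 0 1" 0 "norm z"] e center assms by auto
qed

subsection \<open>Hyperbolic geodesics in the unit ball\<close>

text \<open>This is bilinearity of the Lorentz form \<open>x0 * y0 - X \<bullet> Y\<close> at two
  points \<open>(x0, X)\<close> and \<open>(y0, Y)\<close> of the hyperboloid whose Lorentz product
  is \<open>K\<close>.\<close>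

lemma inner_linear_combination_hyperboloid:
  fixes X Y :: "'a::real_inner"
  assumes X: "(norm X)\<^sup>2 = x0\<^sup>2 - 1" and Y: "(norm Y)\<^sup>2 = y0\<^sup>2 - 1" and XY: "X \<bullet> Y = x0 * y0 - K"
  shows "(\<alpha> *\<^sub>R X + \<beta> *\<^sub>R Y) \<bullet> (\<gamma> *\<^sub>R X + \<delta> *\<^sub>R Y)
       = (\<alpha> * x0 + \<beta> * y0) * (\<gamma> * x0 + \<delta> * y0) - (\<alpha> * \<gamma> + \<beta> * \<delta> + (\<alpha> * \<delta> + \<beta> * \<gamma>) * K)"
proof -
  have "(\<alpha> *\<^sub>R X + \<beta> *\<^sub>R Y) \<bullet> (\<gamma> *\<^sub>R X + \<delta> *\<^sub>R Y)
      = \<alpha> * \<gamma> * (norm X)\<^sup>2 + \<beta> * \<delta> * (norm Y)\<^sup>2 + (\<alpha> * \<delta> + \<beta> * \<gamma>) * (X \<bullet> Y)"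
    by (simp add: power2_norm_eq_inner inner_commute[of Y X] algebra_simps)
  then show ?thesis unfolding X Y XY by (simp add: algebra_simps power2_eq_square)
qed

text \<open>
  The stereographic projection \<open>(z\<^sub>0, Z) \<mapsto> Z / (1 + z\<^sub>0)\<close> from the hyperboloid to the unit ball is
  conformal for the metric \<open>2 |dz| / (1 - |z|\<^sup>2)\<close>.
\<close>

lemma stereographic_velocity:
  fixes Z V :: "'a::real_inner"
  assumes Z: "Z \<bullet> Z = z0\<^sup>2 - 1" and ZV: "Z \<bullet> V = z0 * v0" and V: "V \<bullet> V = v0\<^sup>2 + c\<^sup>2"
    and z0: "0 < 1 + z0" and c: "0 \<le> c"
  shows "norm ((1 / (1 + z0)) *\<^sub>R V - (v0 / (1 + z0)\<^sup>2) *\<^sub>R Z) = c / (1 + z0)"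
    and "1 - (norm ((1 / (1 + z0)) *\<^sub>R Z))\<^sup>2 = 2 / (1 + z0)"
proof -
  \<comment> \<open>The hypotheses place \<open>(z0, Z)\<close> on the hyperboloid and make
    \<open>(v0, V)\<close> a tangent vector of Lorentz length \<open>c\<close>. Scaling by the
    square of \<open>k\<close> clears the denominators.\<close>
  define k where "k = 1 + z0"
  have k: "0 < k" "z0 = k - 1" using z0 by (auto simp: k_def)
  have "(norm (k *\<^sub>R V - v0 *\<^sub>R Z))\<^sup>2 = k\<^sup>2 * (V \<bullet> V) - 2 * k * v0 * (Z \<bullet> V) + v0\<^sup>2 * (Z \<bullet> Z)"
    unfolding power2_norm_eq_inner
    by (simp add: inner_diff_left inner_diff_right inner_commute[of V Z] power2_eq_square algebra_simps)
  also have "\<dots> = (k * c)\<^sup>2"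
    unfolding Z ZV V k(2) by (simp add: power2_eq_square algebra_simps)
  finally have "norm (k *\<^sub>R V - v0 *\<^sub>R Z) = k * c"
    using k(1) c by (simp add: power2_eq_iff_nonneg)
  moreover have "(1 / k) *\<^sub>R V - (v0 / k\<^sup>2) *\<^sub>R Z = (1 / k\<^sup>2) *\<^sub>R (k *\<^sub>R V - v0 *\<^sub>R Z)"
    using k(1) by (simp add: scaleR_diff_right power2_eq_square)
  ultimately show "norm ((1 / (1 + z0)) *\<^sub>R V - (v0 / (1 + z0)\<^sup>2) *\<^sub>R Z) = c / (1 + z0)"
    using k(1) unfolding k_def[symmetric] by (simp add: power2_eq_square)
  have "(norm ((1 / k) *\<^sub>R Z))\<^sup>2 = (z0\<^sup>2 - 1) / k\<^sup>2"
    using Z by (simp add: power_mult_distrib power_divide power2_norm_eq_inner)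
  moreover have "1 - (z0\<^sup>2 - 1) / k\<^sup>2 = 2 / k"
    using k(1) unfolding k(2) by (simp add: field_simps power2_eq_square)
  ultimately show "1 - (norm ((1 / (1 + z0)) *\<^sub>R Z))\<^sup>2 = 2 / (1 + z0)"
    by (simp add: k_def)
qed

text \<open>Here \<open>a\<close> is half the hyperbolic distance, and the speed formula says that
  the hyperbolic speed is constantly \<open>2 * a\<close>. The path is obtained by interpolating on
  the hyperboloid and projecting back to the ball.\<close>

lemma hyperbolic_geodesic:
  fixes x y :: "'a::real_inner"
  assumes x: "norm x < 1" and y: "norm y < 1" and "x \<noteq> y"
    and a: "sinh a = dist x y / sqrt ((1 - (norm x)\<^sup>2) * (1 - (norm y)\<^sup>2))"
  obtains g g' :: "real \<Rightarrow> 'a" where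
    "\<And>t. t \<in> {0..1} \<Longrightarrow> (g has_vector_derivative g' t) (at t within {0..1})"
    "\<And>t. t \<in> {0..1} \<Longrightarrow> norm (g' t) = a * (1 - (norm (g t))\<^sup>2)"
    "\<And>t. t \<in> {0..1} \<Longrightarrow> norm (g t) \<le> max (norm x) (norm y)"
    "g 0 = x" "g 1 = y"
proof -
  define P where "P = 1 - (norm x)\<^sup>2"
  define Q where "Q = 1 - (norm y)\<^sup>2"
  define c where "c = 2 * a"
  \<comment> \<open>The points \<open>(x0, X)\<close> and \<open>(y0, Y)\<close> are the inverse
    stereographic images of \<open>x\<close> and \<open>y\<close>.\<close>
  define X where "X = (2 / P) *\<^sub>R x"
  define Y where "Y = (2 / Q) *\<^sub>R y"
  define x0 where "x0 = 2 / P - 1"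
  define y0 where "y0 = 2 / Q - 1"
  have P: "0 < P" "P \<le> 1" and Q: "0 < Q" "Q \<le> 1"
    using x y by (auto simp: P_def Q_def power_less_one_iff)
  have "0 < sinh a" using a P Q \<open>x \<noteq> y\<close> by (simp add: P_def Q_def)
  then have a0: "0 < a" by simp
  then have c0: "0 < c" by (simp add: c_def)
  have x2: "(norm x)\<^sup>2 = 1 - P" and y2: "(norm y)\<^sup>2 = 1 - Q" by (simp_all add: P_def Q_def)
  have X: "(norm X)\<^sup>2 = x0\<^sup>2 - 1" and Y: "(norm Y)\<^sup>2 = y0\<^sup>2 - 1"
    using P Q unfolding X_def Y_def x0_def y0_def norm_scaleR power_mult_distrib x2 y2
    by (simp_all add: field_simps power2_eq_square)
  have "(sinh a)\<^sup>2 = (dist x y)\<^sup>2 / (P * Q)"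
    using P Q unfolding a P_def[symmetric] Q_def[symmetric] by (simp add: power_divide)
  also have "(dist x y)\<^sup>2 = (1 - P) + (1 - Q) - 2 * (x \<bullet> y)"
    unfolding x2[symmetric] y2[symmetric] dist_norm power2_norm_eq_inner
    by (simp add: inner_diff_left inner_diff_right inner_commute)
  \<comment> \<open>Doubling the argument of \<open>sinh a\<close> identifies \<open>c\<close> as
    the full hyperbolic distance, so that \<open>cosh c\<close> is the Lorentz product of the two
    lifted points.\<close>
  finally have "cosh c = 1 + 2 * (((1 - P) + (1 - Q) - 2 * (x \<bullet> y)) / (P * Q))"
    by (simp add: c_def cosh_double cosh_square_eq)
  then have XY: "X \<bullet> Y = x0 * y0 - cosh c"
    using P Q by (simp add: X_def Y_def x0_def y0_def field_simps)
  have x01: "1 \<le> x0" "1 \<le> y0" using P Q by (simp_all add: x0_def y0_def field_simps)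
  define S where "S = sinh c"
  have S: "0 < S" using c0 by (simp add: S_def)
  \<comment> \<open>These weights are the hyperbolic analogue of spherical linear
    interpolation.\<close>
  define \<alpha> where "\<alpha> t = sinh (c * (1 - t)) / S" for t
  define \<beta> where "\<beta> t = sinh (c * t) / S" for t
  define \<alpha>' where "\<alpha>' t = - c * cosh (c * (1 - t)) / S" for t
  define \<beta>' where "\<beta>' t = c * cosh (c * t) / S" for t
  define Z where "Z t = \<alpha> t *\<^sub>R X + \<beta> t *\<^sub>R Y" for t
  define V where "V t = \<alpha>' t *\<^sub>R X + \<beta>' t *\<^sub>R Y" for t
  define z0 where "z0 t = \<alpha> t * x0 + \<beta> t * y0" for t
  define v0 where "v0 t = \<alpha>' t * x0 + \<beta>' t * y0" for t
  have sum: "sinh c = sinh (c * (1 - t)) * cosh (c * t) + cosh (c * (1 - t)) * sinh (c * t)"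
    "cosh c = cosh (c * (1 - t)) * cosh (c * t) + sinh (c * (1 - t)) * sinh (c * t)" for t
    using sinh_add[of "c * (1 - t)" "c * t"] cosh_add[of "c * (1 - t)" "c * t"] by (simp_all add: algebra_simps)
  \<comment> \<open>In Lorentz terms: the interpolated point stays on the hyperboloid, its velocity
    is tangent, and its speed is \<open>c\<close>.\<close>
  have quad: "\<alpha> t * \<alpha> t + \<beta> t * \<beta> t + (\<alpha> t * \<beta> t + \<beta> t * \<alpha> t) * cosh c = 1"
    "\<alpha> t * \<alpha>' t + \<beta> t * \<beta>' t + (\<alpha> t * \<beta>' t + \<beta> t * \<alpha>' t) * cosh c = 0"
    "\<alpha>' t * \<alpha>' t + \<beta>' t * \<beta>' t + (\<alpha>' t * \<beta>' t + \<beta>' t * \<alpha>' t) * cosh c = - c\<^sup>2" for t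
  proof -
    define p q p' q' where pq: "p = sinh (c * (1 - t))" "q = sinh (c * t)"
      "p' = cosh (c * (1 - t))" "q' = cosh (c * t)"
    have S_eq: "S = p * q' + p' * q" and C_eq: "cosh c = p' * q' + p * q"
      using sum[of t] by (simp_all add: pq S_def)
    have sq: "p'\<^sup>2 = p\<^sup>2 + 1" "q'\<^sup>2 = q\<^sup>2 + 1" by (simp_all add: pq cosh_square_eq)
    have "p * p + q * q + 2 * p * q * (p' * q' + p * q) = (p * q' + p' * q)\<^sup>2"
    proof -
      have "(p * q' + p' * q)\<^sup>2 = p\<^sup>2 * q'\<^sup>2 + p'\<^sup>2 * q\<^sup>2 + 2 * (p * q * (p' * q'))"
        by (simp add: power2_eq_square algebra_simps)
      then show ?thesis unfolding sq by (simp add: power2_eq_square algebra_simps)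
    qed
    moreover have "\<alpha> t * \<alpha> t + \<beta> t * \<beta> t + (\<alpha> t * \<beta> t + \<beta> t * \<alpha> t) * cosh c
        = 1 / S\<^sup>2 * (p * p + q * q + 2 * p * q * (p' * q' + p * q))"
      using S unfolding \<alpha>_def \<beta>_def pq[symmetric] C_eq
      by (simp add: field_simps power2_eq_square)
    ultimately show "\<alpha> t * \<alpha> t + \<beta> t * \<beta> t + (\<alpha> t * \<beta> t + \<beta> t * \<alpha> t) * cosh c = 1"
      using S by (simp flip: S_eq)
    have "- p * p' + q * q' + (p * q' - q * p') * (p' * q' + p * q) = 0"
    proof -
      have "- p * p' + q * q' + (p * q' - q * p') * (p' * q' + p * q)
          = p * p' * (q'\<^sup>2 - q\<^sup>2 - 1) + q * q' * (p\<^sup>2 - p'\<^sup>2 + 1)"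
        by (simp add: power2_eq_square algebra_simps)
      then show ?thesis unfolding sq by simp
    qed
    moreover have "\<alpha> t * \<alpha>' t + \<beta> t * \<beta>' t + (\<alpha> t * \<beta>' t + \<beta> t * \<alpha>' t) * cosh c
        = c / S\<^sup>2 * (- p * p' + q * q' + (p * q' - q * p') * (p' * q' + p * q))"
      using S unfolding \<alpha>_def \<beta>_def \<alpha>'_def \<beta>'_def pq[symmetric] C_eq
      by (simp add: field_simps power2_eq_square)
    ultimately show "\<alpha> t * \<alpha>' t + \<beta> t * \<beta>' t + (\<alpha> t * \<beta>' t + \<beta> t * \<alpha>' t) * cosh c = 0" by simp
    have "p' * p' + q' * q' - 2 * p' * q' * (p' * q' + p * q) = - (p * q' + p' * q)\<^sup>2"
    proof -
      have "p' * p' + q' * q' - 2 * p' * q' * (p' * q' + p * q) + (p * q' + p' * q)\<^sup>2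
          = p'\<^sup>2 * (1 + q\<^sup>2 - q'\<^sup>2) + q'\<^sup>2 * (1 + p\<^sup>2 - p'\<^sup>2)"
        by (simp add: power2_eq_square algebra_simps)
      then show ?thesis unfolding sq by simp
    qed
    moreover have "\<alpha>' t * \<alpha>' t + \<beta>' t * \<beta>' t + (\<alpha>' t * \<beta>' t + \<beta>' t * \<alpha>' t) * cosh c
        = c\<^sup>2 / S\<^sup>2 * (p' * p' + q' * q' - 2 * p' * q' * (p' * q' + p * q))"
      using S unfolding \<alpha>_def \<beta>_def \<alpha>'_def \<beta>'_def pq[symmetric] C_eq
      by (simp add: field_simps power2_eq_square)
    ultimately show "\<alpha>' t * \<alpha>' t + \<beta>' t * \<beta>' t + (\<alpha>' t * \<beta>' t + \<beta>' t * \<alpha>' t) * cosh c = - c\<^sup>2"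
      using S by (simp flip: S_eq)
  qed
  have ZZ: "Z t \<bullet> Z t = (z0 t)\<^sup>2 - 1" and ZV: "Z t \<bullet> V t = z0 t * v0 t" and VV: "V t \<bullet> V t = (v0 t)\<^sup>2 + c\<^sup>2" for t
    unfolding Z_def V_def z0_def v0_def inner_linear_combination_hyperboloid[OF X Y XY] quad
    by (simp_all add: power2_eq_square)
  \<comment> \<open>Since \<open>cosh\<close> is at least 1, the addition formula bounds the sum of
    the weights by 1. Hence the height \<open>z0 t\<close> is at most the larger of the heights of
    the endpoints.\<close>
  have \<alpha>\<beta>: "0 \<le> \<alpha> t" "0 \<le> \<beta> t" "\<alpha> t + \<beta> t \<le> 1" if t: "t \<in> {0..1}" for t
  proof -
    have nonneg: "0 \<le> sinh (c * (1 - t))" "0 \<le> sinh (c * t)" using t c0 by auto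
    then show "0 \<le> \<alpha> t" "0 \<le> \<beta> t" using S by (auto simp: \<alpha>_def \<beta>_def)
    have "sinh (c * (1 - t)) * 1 + 1 * sinh (c * t) \<le> S"
      unfolding S_def sum(1)[of t]
      by (intro add_mono mult_left_mono mult_right_mono nonneg cosh_real_ge_1)
    then show "\<alpha> t + \<beta> t \<le> 1" using S by (simp add: \<alpha>_def \<beta>_def flip: add_divide_distrib)
  qed
  have z0: "0 < 1 + z0 t" if "t \<in> {0..1}" for t
    using \<alpha>\<beta>[OF that] x01 by (simp add: z0_def add_pos_nonneg)
  define g where "g t = (1 / (1 + z0 t)) *\<^sub>R Z t" for t
  define g' where "g' t = (1 / (1 + z0 t)) *\<^sub>R V t - (v0 t / (1 + z0 t)\<^sup>2) *\<^sub>R Z t" for t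
  have ng: "1 - (norm (g t))\<^sup>2 = 2 / (1 + z0 t)" if "t \<in> {0..1}" for t
    using stereographic_velocity(2)[OF ZZ ZV VV z0[OF that]] c0 by (simp add: g_def)
  show ?thesis
  proof (rule that)
    have d\<alpha>: "(\<alpha> has_real_derivative \<alpha>' t) (at t within {0..1})"
      and d\<beta>: "(\<beta> has_real_derivative \<beta>' t) (at t within {0..1})" for t
      unfolding \<alpha>_def \<beta>_def \<alpha>'_def \<beta>'_def using S
      by (auto intro!: derivative_eq_intros simp: field_simps)
    have dz: "(z0 has_real_derivative v0 t) (at t within {0..1})" for t
      unfolding z0_def v0_def by (auto intro!: derivative_eq_intros d\<alpha> d\<beta>)
    have dZ: "(Z has_vector_derivative V t) (at t within {0..1})" for t
      unfolding Z_def V_def by (auto intro!: derivative_eq_intros d\<alpha> d\<beta>)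
    fix t :: real assume t: "t \<in> {0..1}"
    show "(g has_vector_derivative g' t) (at t within {0..1})"
      unfolding g_def g'_def using z0[OF t]
      by (auto intro!: derivative_eq_intros dz dZ simp: power2_eq_square)
    show "norm (g' t) = a * (1 - (norm (g t))\<^sup>2)"
      using stereographic_velocity(1)[OF ZZ ZV VV z0[OF t]] c0 unfolding ng[OF t]
      by (simp add: g'_def c_def)
    define r where "r = max (norm x) (norm y)"
    have r: "0 \<le> r" "r\<^sup>2 < 1" "norm x \<le> r" "norm y \<le> r"
      using x y by (auto simp: r_def max_def power_less_one_iff)
    \<comment> \<open>\<open>M\<close> is the height of hyperboloid points that project to norm
      \<open>r\<close>, so the bound on the height becomes the bound on the norm.\<close>
    define M where "M = 2 / (1 - r\<^sup>2) - 1"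
    have "1 - r\<^sup>2 \<le> P" "1 - r\<^sup>2 \<le> Q"
      using r by (auto simp: P_def Q_def intro!: power_mono)
    then have M: "x0 \<le> M" "y0 \<le> M" using r(2) P Q by (auto simp: M_def x0_def y0_def intro!: frac_le)
    have "z0 t \<le> \<alpha> t * M + \<beta> t * M"
      unfolding z0_def using \<alpha>\<beta>[OF t] M by (intro add_mono mult_left_mono)
    also have "\<dots> = (\<alpha> t + \<beta> t) * M" by (simp add: algebra_simps)
    also have "\<dots> \<le> 1 * M" using \<alpha>\<beta>[OF t] M x01 by (intro mult_right_mono) auto
    finally have "1 + z0 t \<le> 2 / (1 - r\<^sup>2)" by (simp add: M_def)
    then have "1 - r\<^sup>2 \<le> 2 / (1 + z0 t)" using z0[OF t] r(2) by (simp add: field_simps)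
    then have "(norm (g t))\<^sup>2 \<le> r\<^sup>2" using ng[OF t] by simp
    then have "norm (g t) \<le> r" using r(1) by (rule power2_le_imp_le)
    then show "norm (g t) \<le> max (norm x) (norm y)" by (simp only: r_def)
  next
    show "g 0 = x" using P S by (simp add: g_def Z_def z0_def \<alpha>_def \<beta>_def S_def x0_def X_def)
    show "g 1 = y" using Q S by (simp add: g_def Z_def z0_def \<alpha>_def \<beta>_def S_def y0_def Y_def)
  qed
qed

text \<open>Both sides are compared after applying \<open>sinh\<close>. With
  \<open>t = D / (1 - r)\<close> the right side is \<open>ln (1 + t)\<close>, and replacing both
  norms by their maximum \<open>r\<close> leaves \<open>t / (1 + r)\<close> on the left.\<close>

lemma half_hyperbolic_distance_le_distance_ratio_metric:
  fixes x y :: "'a::euclidean_space"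
  assumes x: "norm x < 1" and y: "norm y < 1"
  shows "arsinh (dist x y / sqrt ((1 - (norm x)\<^sup>2) * (1 - (norm y)\<^sup>2))) \<le> distance_ratio_metric (ball 0 1) x y"
proof -
  define r where "r = max (norm x) (norm y)"
  define D where "D = dist x y"
  define t where "t = D / (1 - r)"
  have r: "0 \<le> r" "r < 1" "norm x \<le> r" "norm y \<le> r" using x y by (auto simp: r_def max_def)
  have D: "0 \<le> D" "D \<le> 2 * r"
    using norm_triangle_ineq4[of x y] r by (auto simp: D_def dist_norm)
  have t: "0 \<le> t" "t * (1 - r) = D" using r D by (auto simp: t_def)
  have r2: "r\<^sup>2 < 1" using r by (simp add: power_less_one_iff)
  have "(1 - r\<^sup>2) * (1 - r\<^sup>2) \<le> (1 - (norm x)\<^sup>2) * (1 - (norm y)\<^sup>2)"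
    using r r2 by (intro mult_mono diff_left_mono power_mono) (auto simp: power_le_one)
  then have "1 - r\<^sup>2 \<le> sqrt ((1 - (norm x)\<^sup>2) * (1 - (norm y)\<^sup>2))"
    by (intro real_le_rsqrt) (simp add: power2_eq_square)
  then have "D / sqrt ((1 - (norm x)\<^sup>2) * (1 - (norm y)\<^sup>2)) \<le> D / (1 - r\<^sup>2)"
    using r2 D x y by (intro divide_left_mono mult_pos_pos) (auto simp: power_less_one_iff)
  also have "\<dots> = t / (1 + r)"
    using r by (simp add: t_def power2_eq_square field_simps)
  also have "\<dots> \<le> t * (2 + t) / (2 * (1 + t))"
  proof -
    \<comment> \<open>After expansion this reduces to \<open>D \<le> 2 * r\<close>, which holds
      because both points have norm at most \<open>r\<close>.\<close>
    have "t * (2 * (1 + t)) \<le> t * ((2 + t) * (1 + r))"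
      using D t by (intro mult_left_mono) (auto simp: algebra_simps)
    then show ?thesis using r t by (simp add: field_simps)
  qed
  also have "\<dots> = sinh (ln (1 + t))"
    using t by (simp add: sinh_ln_real field_simps)
  finally have "arsinh (D / sqrt ((1 - (norm x)\<^sup>2) * (1 - (norm y)\<^sup>2))) \<le> ln (1 + t)"
    by (metis sinh_arsinh_real sinh_real_le_iff)
  moreover have "min (1 - norm x) (1 - norm y) = 1 - r" by (auto simp: r_def)
  ultimately show ?thesis
    using x y by (simp add: distance_ratio_metric_def bdist_ball t_def D_def)
qed

lemma quasihyperbolic_metric_ball_le:
  fixes x y :: "'a::euclidean_space"
  assumes "s < 1" and x: "norm x < s" and y: "norm y < s"
  shows "quasihyperbolic_metric (ball 0 1) x y \<le> (1 + s) * distance_ratio_metric (ball 0 1) x y"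
proof -
  define a where "a = arsinh (dist x y / sqrt ((1 - (norm x)\<^sup>2) * (1 - (norm y)\<^sup>2)))"
  have s: "0 < s" using x norm_ge_zero[of x] by linarith
  have xy: "norm x < 1" "norm y < 1" using assms by auto
  have a: "0 \<le> a" "a \<le> distance_ratio_metric (ball 0 1) x y"
  proof -
    have "0 \<le> (1 - (norm x)\<^sup>2) * (1 - (norm y)\<^sup>2)"
      using xy by (simp add: power_le_one)
    then have "0 \<le> sinh a" by (simp add: a_def)
    then show "0 \<le> a" by simp
  qed (use half_hyperbolic_distance_le_distance_ratio_metric[OF xy] in \<open>simp add: a_def\<close>)
  obtain g g' :: "real \<Rightarrow> 'a" where g:
    "\<And>t. t \<in> {0..1} \<Longrightarrow> (g has_vector_derivative g' t) (at t within {0..1})"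
    "\<And>t. t \<in> {0..1} \<Longrightarrow> norm (g' t) = a * (1 - (norm (g t))\<^sup>2)"
    "\<And>t. t \<in> {0..1} \<Longrightarrow> norm (g t) \<le> max (norm x) (norm y)"
    "g 0 = x" "g 1 = y"
  \<comment> \<open>Coinciding points give \<open>a = 0\<close> and are joined by the constant
    path.\<close>
  proof (cases "x = y")
    case True
    then show ?thesis using that[of "\<lambda>_. x" "\<lambda>_. 0"] by (simp add: a_def)
  next
    case False
    then show ?thesis using hyperbolic_geodesic[OF xy False, of a] that by (auto simp: a_def)
  qed
  have gs: "norm (g t) < s" if "t \<in> {0..1}" for t using g(3)[OF that] x y by auto
  have "quasihyperbolic_metric (ball 0 1) x y \<le> a * (1 + s)"
  proof (rule quasihyperbolic_metric_le_smooth[OF _ _ g(1)])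
    have "continuous_on {0..1} g"
      using g(1) has_vector_derivative_continuous continuous_on_eq_continuous_within by blast
    then have "continuous_on {0..1} (\<lambda>t. a * (1 - (norm (g t))\<^sup>2))"
      by (intro continuous_intros)
    then show "continuous_on {0..1} (\<lambda>t. norm (g' t))"
      using g(2) by (subst continuous_on_cong[OF refl]) auto
    show "((\<lambda>_. a * (1 + s)) has_integral a * (1 + s)) {0..1::real}"
      using has_integral_const_real[of "a * (1 + s)" 0 1] by simp
    show "frontier (ball 0 1 :: 'a set) \<noteq> {}"
      using vector_choose_size[of 1, where 'a = 'a] by auto
    fix t :: real assume t: "t \<in> {0..1}"
    have lt: "norm (g t) < 1" using gs[OF t] assms(1) by simp
    \<comment> \<open>The boundary distance cancels one factor of \<open>1 - |g t|^2\<close>, and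
      the remaining factor is below \<open>1 + s\<close>.\<close>
    have "norm (g' t) / bdist (ball 0 1) (g t) = a * (1 + norm (g t))"
      using lt by (simp add: g(2)[OF t] bdist_ball field_simps power2_eq_square)
    also have "\<dots> \<le> a * (1 + s)" using a gs[OF t] by (intro mult_left_mono) auto
    finally show "norm (g' t) / bdist (ball 0 1) (g t) \<le> a * (1 + s)" .
    show "g t \<in> ball 0 1" using lt by simp
  qed (use g in auto)
  also have "\<dots> \<le> distance_ratio_metric (ball 0 1) x y * (1 + s)"
    using a s by (intro mult_right_mono) auto
  finally show ?thesis by (simp add: mult.commute)
qed

section \<open>Passing to the infimum over paths, and the two parts of the theorem\<close>

lemma distance_ratio_metric_le_quasihyperbolic_metric:
  assumes "open G" "frontier G \<noteq> {}"
    and "rectifiable_path p" "path_image p \<subseteq> G" "pathstart p = x" "pathfinish p = y"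
  shows "distance_ratio_metric G x y \<le> quasihyperbolic_metric G x y"
  unfolding quasihyperbolic_metric_def
proof (rule cInf_greatest)
  \<comment> \<open>The path \<open>p\<close> witnesses that the infimum is taken over a nonempty
    set.\<close>
  show "{line_integral g (\<lambda>z. 1 / bdist G z) |g.
      rectifiable_path g \<and> path_image g \<subseteq> G \<and> pathstart g = x \<and> pathfinish g = y} \<noteq> {}"
    using assms by blast
qed (use distance_ratio_metric_le_line_integral[OF assms(1,2)] in blast)

lemma rectifiable_path_linepath: "rectifiable_path (linepath a b :: real \<Rightarrow> 'a::real_normed_vector)"
  by (rule rectifiable_smooth_path[OF has_vector_derivative_linepath_within]) simp

theorem theorem2p5:
  shows "(\<forall>(s::real) (x::real^'n) (y::real^'n).
            0 < s \<and> s < 1 \<and> x \<in> ball 0 s \<and> y \<in> ball 0 s \<longrightarrow>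
              distance_ratio_metric (ball 0 1) x y \<le> quasihyperbolic_metric (ball 0 1) x y \<and>
              quasihyperbolic_metric (ball 0 1) x y \<le> (1 + s) * distance_ratio_metric (ball 0 1) x y)
       \<and> (\<forall>(G::(real^'n) set) w w0 (s::real) x y.
            proper_domain G \<and> w \<in> G \<and> w0 \<in> frontier G \<inter> sphere w (bdist G w) \<and>
            0 < s \<and> s < 1 \<and>
            x \<in> ball w (s * bdist G w) \<inter> closed_segment w w0 \<and>
            y \<in> ball w (s * bdist G w) \<inter> closed_segment w w0 \<longrightarrow>
              quasihyperbolic_metric G x y \<le> (1 + s) * distance_ratio_metric G x y)"
proof (intro conjI allI impI; elim conjE)
  fix s :: real and x y :: "real^'n"
  assume s: "0 < s" "s < 1" and xy: "x \<in> ball 0 s" "y \<in> ball 0 s"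
  then have "closed_segment x y \<subseteq> ball 0 1"
    by (intro closed_segment_subset convex_ball) auto
  moreover have "frontier (ball 0 1 :: (real^'n) set) \<noteq> {}"
    using vector_choose_size[of 1, where 'a = "real^'n"] by auto
  ultimately show "distance_ratio_metric (ball 0 1) x y \<le> quasihyperbolic_metric (ball 0 1) x y"
    using rectifiable_path_linepath[of x y]
    by (intro distance_ratio_metric_le_quasihyperbolic_metric) auto
  show "quasihyperbolic_metric (ball 0 1) x y \<le> (1 + s) * distance_ratio_metric (ball 0 1) x y"
    using s xy by (intro quasihyperbolic_metric_ball_le) auto
next
  fix G :: "(real^'n) set" and w w0 x y and s :: real
  assume "proper_domain G" "w \<in> G" and w0: "w0 \<in> frontier G \<inter> sphere w (bdist G w)"
    and s: "0 < s" "s < 1"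
    and x: "x \<in> ball w (s * bdist G w) \<inter> closed_segment w w0"
    and y: "y \<in> ball w (s * bdist G w) \<inter> closed_segment w w0"
  then have G: "open G" by (simp add: proper_domain_def)
  have w0': "w0 \<in> frontier G" "dist w w0 = bdist G w" using w0 by auto
  have d: "0 < bdist G w" using bdist_pos[OF G _ \<open>w \<in> G\<close>] w0' by auto
  have param: "\<exists>c. 0 \<le> c \<and> c < 1 \<and> z = w + c *\<^sub>R (w0 - w)"
    if z: "z \<in> ball w (s * bdist G w) \<inter> closed_segment w w0" for z
  proof -
    obtain c where c: "0 \<le> c" "z = w + c *\<^sub>R (w0 - w)"
      using z by (auto simp: closed_segment_def algebra_simps)
    \<comment> \<open>The left side is the distance from \<open>w\<close> to \<open>z\<close>, so
      \<open>c\<close> is below \<open>s\<close> and hence below 1.\<close>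
    have "c * bdist G w < s * bdist G w"
      using z c w0'(2) by (simp add: dist_norm norm_minus_commute)
    then show ?thesis using c d s by auto
  qed
  obtain a b where ab: "0 \<le> a" "a < 1" "0 \<le> b" "b < 1"
    "x = w + a *\<^sub>R (w0 - w)" "y = w + b *\<^sub>R (w0 - w)"
    using param[OF x] param[OF y] by blast
  have inG: "w + c *\<^sub>R (w0 - w) \<in> G" if c: "0 \<le> c" "c < 1" for c
  \<comment> \<open>A connected ball around \<open>w\<close> that leaves \<open>G\<close> would meet
    the frontier at a distance below \<open>bdist G w\<close>.\<close>
  proof (rule ccontr)
    assume "w + c *\<^sub>R (w0 - w) \<notin> G"
    moreover have "connected (ball w (bdist G w))" by simp
    moreover have "w + c *\<^sub>R (w0 - w) \<in> ball w (bdist G w)"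
      using c d w0'(2) by (simp add: dist_norm norm_minus_commute)
    ultimately have "ball w (bdist G w) \<inter> frontier G \<noteq> {}"
      using \<open>w \<in> G\<close> d by (intro connected_Int_frontier) (blast intro: centre_in_ball[THEN iffD2])+
    then obtain z where "dist w z < bdist G w" "z \<in> frontier G" by auto
    then show False using infdist_le[of z "frontier G" w] by (simp add: bdist_def)
  qed
  have "quasihyperbolic_metric G x y \<le> distance_ratio_metric G x y"
    unfolding ab(5,6) by (rule quasihyperbolic_metric_le_radial[OF G w0' d ab(1-4) inG])
  \<comment> \<open>On a radial segment the bound holds with factor 1, and enlarging the factor is
    harmless because the distance ratio metric is nonnegative.\<close>
  also have "\<dots> \<le> (1 + s) * distance_ratio_metric G x y"
  proof -
    have "0 \<le> distance_ratio_metric G x y"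
      unfolding distance_ratio_metric_def by (simp add: bdist_def infdist_nonneg)
    then show ?thesis using s by (simp add: mult_le_cancel_right1)
  qed
  finally show "quasihyperbolic_metric G x y \<le> (1 + s) * distance_ratio_metric G x y" .
qed

end
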